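(* A classical noncrossing partition of $[n+1]=\{1,\dots,n+1\}$ is positive if and only if $1$ and $n+1$ lie in the same block.
   Context: A classical noncrossing partition of $[m]=\{1,\dots,m\}$ is a set partition of $[m]$ such that whenever $1\leq a<b<c<d\leq m$ with $a,c$ in a block $\mathcal{B}_i$ and $b,d$ in a block $\mathcal{B}_j$, then $\mathcal{B}_i=\mathcal{B}_j$. The set of these is denoted $NC(m)$. Let $W=\mathfrak{S}_{n+1}$ be the Coxeter group of type $A_n$, with simple generators $s_i=(i\ i+1)$, $1\leq i\leq n$, with reflections $T$ = all transpositions, and with Coxeter element $c=s_1s_2\cdots s_n=(1\ 2\ \cdots\ n+1)$ (this is the Coxeter element adapted with respect to sinks to the linearly oriented quiver $n\to n-1\to\cdots\to 1$). Let $l_T(w)$ be the minimal length of $w$ as a product of reflections, and put $u\leq_T v$ iff $l_T(v)=l_T(u)+l_T(u^{-1}v)$. $NC(A_n)$ is the set of $w\in W$ with $1\leq_T w\leq_T c$. Sending a permutation to the set partition of $[n+1]$ given by its disjoint cycles (including $1$-cycles) is a bijection (Biane's poset isomorphism) $NC(A_n)\to NC(n+1)$. An element of $NC(A_n)$ is positive if it is not contained in any proper standard parabolic subgroup (a subgroup generated by a proper subset of $\{s_1,\dots,s_n\}$). A classical noncrossing partition of $[n+1]$ is called positive if the corresponding element of $NC(A_n)$ is positive. *)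

theory Defs
  imports
    "HOL-Algebra.Sym_Groups"
    "HOL-Combinatorics.Orbits"
    "HOL-Library.Disjoint_Sets"
begin

definition noncrossing_partitions :: "nat \<Rightarrow> nat set set set" where
  "noncrossing_partitions m =
     {P. partition_on {1..m} P \<and>
         (\<forall>a b c d. \<forall>Bi\<in>P. \<forall>Bj\<in>P.
            1 \<le> a \<and> a < b \<and> b < c \<and> c < d \<and> d \<le> m \<and>
            a \<in> Bi \<and> c \<in> Bi \<and> b \<in> Bj \<and> d \<in> Bj \<longrightarrow> Bi = Bj)}"

definition group_prod :: "('a, 'b) monoid_scheme \<Rightarrow> 'a list \<Rightarrow> 'a" where
  "group_prod G xs = foldr (\<lambda>x y. x \<otimes>\<^bsub>G\<^esub> y) xs \<one>\<^bsub>G\<^esub>"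

definition word_len :: "('a, 'b) monoid_scheme \<Rightarrow> 'a set \<Rightarrow> 'a \<Rightarrow> nat" where
  "word_len G T w = (LEAST k. \<exists>ts. length ts = k \<and> set ts \<subseteq> T \<and> group_prod G ts = w)"

definition abs_le :: "('a, 'b) monoid_scheme \<Rightarrow> 'a set \<Rightarrow> 'a \<Rightarrow> 'a \<Rightarrow> bool" where
  "abs_le G T u v \<longleftrightarrow>
     word_len G T v = word_len G T u + word_len G T (inv\<^bsub>G\<^esub> u \<otimes>\<^bsub>G\<^esub> v)"

text \<open>The Coxeter group of type A with n simple generators is the symmetric group
  on n + 1 letters.\<close>

abbreviation cox_A :: "nat \<Rightarrow> (nat \<Rightarrow> nat) monoid" where
  "cox_A n \<equiv> sym_group (n + 1)"

definition simple_gen :: "nat \<Rightarrow> nat \<Rightarrow> nat" where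
  "simple_gen i = Transposition.transpose i (i + 1)"

definition simple_gens :: "nat \<Rightarrow> (nat \<Rightarrow> nat) set" where
  "simple_gens n = simple_gen ` {1..n}"

definition reflections_A :: "nat \<Rightarrow> (nat \<Rightarrow> nat) set" where
  "reflections_A n =
     {Transposition.transpose i j | i j. 1 \<le> i \<and> i < j \<and> j \<le> n + 1}"

definition coxeter_elt :: "nat \<Rightarrow> nat \<Rightarrow> nat" where
  "coxeter_elt n = group_prod (cox_A n) (map simple_gen [1..<n + 1])"

text \<open>The product in the symmetric group is composition of functions (right factor
  applied first); with this convention \<open>coxeter_elt n\<close> is the cycle
  \<open>(1 2 \<dots> n+1)\<close>.\<close>

lemma coxeter_elt_apply:
  "coxeter_elt n i =
     (if 1 \<le> i \<and> i \<le> n then i + 1 else if i = n + 1 then 1 else i)"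
proof -
  have move: "foldr (\<circ>) xs g = foldr (\<circ>) xs id \<circ> g" for xs and g :: "nat \<Rightarrow> nat"
    by (induction xs) auto
  have "foldr (\<circ>) (map simple_gen [1..<n + 1]) id i =
     (if 1 \<le> i \<and> i \<le> n then i + 1 else if i = n + 1 then 1 else i)"
  proof (induction n arbitrary: i)
    case (Suc n)
    have "[1..<Suc n + 1] = [1..<n + 1] @ [n + 1]" by simp
    then have "foldr (\<circ>) (map simple_gen [1..<Suc n + 1]) id =
        foldr (\<circ>) (map simple_gen [1..<n + 1]) (simple_gen (n + 1))"
      by (simp only: map_append foldr_append) simp
    also have "\<dots> = foldr (\<circ>) (map simple_gen [1..<n + 1]) id \<circ> simple_gen (n + 1)"
      by (rule move)
    finally have eq: "foldr (\<circ>) (map simple_gen [1..<Suc n + 1]) id =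
        foldr (\<circ>) (map simple_gen [1..<n + 1]) id \<circ> simple_gen (n + 1)" .
    show ?case
      by (subst eq, subst comp_apply, subst Suc.IH)
        (auto simp: simple_gen_def Transposition.transpose_def)
  qed simp
  then show ?thesis
    by (simp add: coxeter_elt_def group_prod_def sym_group_def)
qed

definition NC_A :: "nat \<Rightarrow> (nat \<Rightarrow> nat) set" where
  "NC_A n = {w \<in> carrier (cox_A n).
     abs_le (cox_A n) (reflections_A n) \<one>\<^bsub>cox_A n\<^esub> w \<and>
     abs_le (cox_A n) (reflections_A n) w (coxeter_elt n)}"

text \<open>\<open>orbit w i\<close> is the support of the cycle of \<open>w\<close> through \<open>i\<close>; it is \<open>{i}\<close> if \<open>i\<close> is
  fixed, so 1-cycles give singleton blocks.\<close>

definition cycle_partition :: "nat \<Rightarrow> (nat \<Rightarrow> nat) \<Rightarrow> nat set set" where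
  "cycle_partition n w = orbit w ` {1..n + 1}"

definition positive_elt :: "nat \<Rightarrow> (nat \<Rightarrow> nat) \<Rightarrow> bool" where
  "positive_elt n w \<longleftrightarrow>
     w \<in> NC_A n \<and> \<not> (\<exists>J. J \<subset> simple_gens n \<and> w \<in> generate (cox_A n) J)"

text \<open>By Biane's theorem \<open>cycle_partition n\<close> is a bijection from \<open>NC_A n\<close> onto
  \<open>noncrossing_partitions (n + 1)\<close>; its inverse gives the element corresponding to a
  partition.\<close>

definition positive_partition :: "nat \<Rightarrow> nat set set \<Rightarrow> bool" where
  "positive_partition n P \<longleftrightarrow>
     P \<in> noncrossing_partitions (n + 1) \<and>
     positive_elt n (the_inv_into (NC_A n) (cycle_partition n) P)"

end

theory Submission
  imports Defs
begin

text \<open>The reflection length of a permutation of \<open>n + 1\<close> letters is \<open>n + 1\<close> minus its number of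
  cycles, and every cycle contains a weak descent \<open>w i \<le> i\<close>, namely its maximum. The weak
  descents of \<open>w\<close> and of its complement \<open>w\<^sup>-\<^sup>1c\<close> always number \<open>n + 2\<close> in total, so \<open>w \<le>\<^sub>T c\<close> holds
  exactly if every cycle of \<open>w\<close> and of \<open>w\<^sup>-\<^sup>1c\<close> has just one weak descent. A permutation with this
  property runs through each of its cycles in increasing order and is thus determined by its
  cycle partition; conversely, the increasing permutation of a noncrossing partition satisfies
  the criterion. If the block of 1 has maximum \<open>k \<le> n\<close>, no block of a noncrossing partition
  straddles \<open>{1..k}\<close>, so the permutation avoids \<open>s\<^sub>k\<close>; conversely, a parabolic subgroup avoiding
  \<open>s\<^sub>k\<close> preserves \<open>{1..k}\<close> and cannot connect 1 to \<open>n + 1\<close>.\<close>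

section \<open>Cycles and reflection length\<close>

definition cycle_count :: "'a set \<Rightarrow> ('a \<Rightarrow> 'a) \<Rightarrow> nat" where
  "cycle_count S w = card (orbit w ` S)"

definition reflections_on :: "'a set \<Rightarrow> ('a \<Rightarrow> 'a) set" where
  "reflections_on S = {Transposition.transpose x y | x y. x \<in> S \<and> y \<in> S \<and> x \<noteq> y}"

lemma orbit_eq_orbit_if_mem:
  assumes "permutation w" "y \<in> orbit w x"
  shows "orbit w y = orbit w x"
  using orbit_cyclic_eq3[OF cyclic_on_orbit'[OF assms(1)] assms(2)] .

lemma orbit_subset_if_closed:
  assumes "x \<in> A" "\<And>y. y \<in> A \<Longrightarrow> w y \<in> A"
  shows "orbit w x \<subseteq> A"
proof
  fix y assume "y \<in> orbit w x"
  then show "y \<in> A" by induction (use assms in auto)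
qed

text \<open>A \<open>w\<close>-invariant labelling is constant on cycles, so it factors through
  \<open>orbit w\<close>. Cycle counts are bounded from below by exhibiting labellings with many
  values.\<close>

lemma card_image_le_cycle_count:
  assumes w: "permutation w" and S: "finite S" and f: "\<And>x. f (w x) = f x"
  shows "card (f ` S) \<le> cycle_count S w"
proof -
  have const: "f y = f x" if "y \<in> orbit w x" for x y
    using that by induction (simp_all add: f)
  define g where "g Q = f (SOME y. y \<in> Q)" for Q
  have "f x = g (orbit w x)" for x
    unfolding g_def using permutation_self_in_orbit[OF w, of x]
    by (metis const someI_ex)
  then have "f ` S = g ` (orbit w ` S)" by (auto simp: image_image)
  then show ?thesis unfolding cycle_count_def
    by (simp add: card_image_le S)
qed

lemma cycle_count_le_card: "finite S \<Longrightarrow> cycle_count S w \<le> card S"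
  unfolding cycle_count_def by (rule card_image_le)

lemma cycle_count_id: "cycle_count S id = card S"
proof -
  have "orbit id x = {x}" for x :: 'a by (simp add: orbit_eq_singleton_iff)
  then show ?thesis unfolding cycle_count_def by (simp add: card_image)
qed

text \<open>Identify the cycles of \<open>a\<close> and \<open>b\<close>: the resulting labelling is invariant under
  \<open>transpose a b \<circ> w\<close> and loses at most one value.\<close>

lemma cycle_count_transpose_le:
  assumes w: "permutation w" and S: "finite S"
  shows "cycle_count S w \<le> Suc (cycle_count S (Transposition.transpose a b \<circ> w))"
proof -
  define t where "t = Transposition.transpose a b"
  define f where "f x = (if orbit w x = orbit w b then orbit w a else orbit w x)" for x
  have step: "orbit w (w x) = orbit w x" for x
    by (rule permutation_orbit_step[OF w])
  have "f (t x) = f x" for x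
    by (auto simp: f_def t_def Transposition.transpose_def)
  moreover have "f (w x) = f x" for x by (simp add: f_def step)
  ultimately have inv: "f ((t \<circ> w) x) = f x" for x by simp
  have "permutation (t \<circ> w)"
    unfolding t_def by (intro permutation_compose permutation_swap_id w)
  then have 1: "card (f ` S) \<le> cycle_count S (t \<circ> w)"
    using S inv by (rule card_image_le_cycle_count)
  have "orbit w ` S \<subseteq> insert (orbit w b) (f ` S)"
    by (auto simp: f_def)
  then have "card (orbit w ` S) \<le> card (insert (orbit w b) (f ` S))"
    by (intro card_mono) (use S in auto)
  also have "\<dots> \<le> Suc (card (f ` S))" by (rule card_insert_le_m1) auto
  finally show ?thesis using 1 unfolding cycle_count_def t_def by simp
qed

lemma reflections_on_permutes: "t \<in> reflections_on S \<Longrightarrow> t permutes S"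
  unfolding reflections_on_def by (auto intro: permutes_swap_id)

text \<open>The identity has \<open>card S\<close> cycles, and each further letter lowers the count
  by at most one. This bounds the length of every reflection word from below.\<close>

lemma card_le_cycle_count_add_length:
  assumes S: "finite S" and ts: "set ts \<subseteq> reflections_on S"
  shows "foldr (\<circ>) ts id permutes S \<and> card S \<le> cycle_count S (foldr (\<circ>) ts id) + length ts"
  using ts
proof (induction ts)
  case Nil
  then show ?case using permutes_id[of S] cycle_count_id[of S] by (simp add: id_def)
next
  case (Cons t ts)
  let ?w = "foldr (\<circ>) ts id"
  from Cons.prems have t: "t \<in> reflections_on S" and "set ts \<subseteq> reflections_on S" by simp_all
  from Cons.IH[OF this(2)] have IH: "?w permutes S" "card S \<le> cycle_count S ?w + length ts"
    by (rule conjunct1, rule conjunct2)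
  from t obtain a b where tab: "t = Transposition.transpose a b"
    unfolding reflections_on_def by auto
  have "permutation ?w" using IH(1) S permutation_permutes by blast
  from cycle_count_transpose_le[OF this S, of a b] IH(2)
  have "card S \<le> cycle_count S (t \<circ> ?w) + length (t # ts)" unfolding tab by simp
  moreover have "(t \<circ> ?w) permutes S"
    by (rule permutes_compose[OF IH(1) reflections_on_permutes[OF t]])
  ultimately show ?case unfolding foldr_Cons comp_apply[of "(\<circ>) t"] by blast
qed

text \<open>Composing with \<open>(x w(x))\<close> splits the fixed point \<open>x\<close> off its cycle.\<close>

lemma reflection_word_in_cycles:
  assumes S: "finite S" and w: "w permutes S"
  shows "\<exists>ts. length ts + cycle_count S w \<le> card S \<and> foldr (\<circ>) ts id = w \<and>
    (\<forall>t\<in>set ts. \<exists>x\<in>S. \<exists>y\<in>orbit w x. x \<noteq> y \<and> t = Transposition.transpose x y)"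
  using w
proof (induction "card S - cycle_count S w" arbitrary: w rule: less_induct)
  case less
  note w = less.prems
  have pw: "permutation w" using w S permutation_permutes by blast
  show ?case
  proof (cases "w = id")
    case True
    then show ?thesis by (intro exI[of _ "[]"]) (simp add: cycle_count_id)
  next
    case False
    then obtain x where x: "w x \<noteq> x" by (auto simp: fun_eq_iff)
    then have xS: "x \<in> S" using w by (meson permutes_not_in)
    then have wxS: "w x \<in> S" by (simp add: permutes_in_image[OF w])
    define t where "t = Transposition.transpose x (w x)"
    define v where "v = t \<circ> w"
    have tv: "t \<circ> v = w" by (auto simp: v_def t_def fun_eq_iff)
    have v: "v permutes S"
      unfolding v_def t_def by (intro permutes_compose w permutes_swap_id xS wxS)
    then have pv: "permutation v" using S permutation_permutes by blast
    have vx: "v x = x" by (simp add: v_def t_def)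
    have v_orbit: "v y \<in> orbit w y" for y
    proof (cases "w y = x \<or> y = x")
      case True
      then show ?thesis
        using permutation_self_in_orbit[OF pw, of x] orbit.base[of w y] orbit.step[of x w y] vx
        by (auto simp: v_def t_def)
    next
      case False
      then have "w y \<noteq> w x" using w by (metis permutes_inj injD)
      with False show ?thesis by (simp add: v_def t_def orbit.base Transposition.transpose_def)
    qed
    \<comment> \<open>Cycles of \<open>v\<close> lie inside cycles of \<open>w\<close>, so the
      letters found recursively for \<open>v\<close> are admissible for \<open>w\<close>.\<close>
    have orbit_sub: "orbit v y \<subseteq> orbit w y" for y
    proof (rule orbit_subset_if_closed)
      show "y \<in> orbit w y" by (rule permutation_self_in_orbit[OF pw])
      show "v z \<in> orbit w y" if "z \<in> orbit w y" for z
        using v_orbit[of z] that by (rule orbit_trans)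
    qed
    \<comment> \<open>The empty set is a fresh label for the new fixed point \<open>x\<close>,
      distinct from every orbit.\<close>
    define f where "f y = (if y = x then {} else orbit w y)" for y
    have "f (v y) = f y" for y
    proof (cases "y = x")
      case False
      then have "v y \<noteq> x" using vx v by (metis permutes_inj injD)
      with False show ?thesis
        using orbit_eq_orbit_if_mem[OF pw v_orbit[of y]] by (simp add: f_def)
    qed (simp add: vx)
    then have "card (f ` S) \<le> cycle_count S v"
      by (intro card_image_le_cycle_count pv S)
    moreover have "insert {} (orbit w ` S) \<subseteq> f ` S"
    proof -
      \<comment> \<open>The old cycle of \<open>x\<close> keeps its label at \<open>w x\<close>,
        which differs from \<open>x\<close>.\<close>
      have "orbit w y \<in> f ` S" if "y \<in> S" for y
      proof (cases "y = x")
        case True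
        have "f (w x) = orbit w x"
          using x permutation_orbit_step[OF pw, of x] by (simp add: f_def)
        then show ?thesis using wxS True by (metis imageI)
      qed (use that in \<open>auto simp: f_def\<close>)
      moreover have "{} = f x" by (simp add: f_def)
      ultimately show ?thesis using xS by blast
    qed
    then have "card (insert {} (orbit w ` S)) \<le> card (f ` S)"
      by (intro card_mono) (use S in auto)
    moreover have "card (insert {} (orbit w ` S)) = Suc (cycle_count S w)"
      unfolding cycle_count_def using S orbit_nonempty[of w] by (subst card_insert_disjoint) auto
    ultimately have more: "Suc (cycle_count S w) \<le> cycle_count S v" by simp
    have "cycle_count S v \<le> card S" by (rule cycle_count_le_card[OF S])
    with more have "card S - cycle_count S v < card S - cycle_count S w" by simp
    from less.hyps[OF this v] obtain ts where ts:
      "length ts + cycle_count S v \<le> card S" "foldr (\<circ>) ts id = v"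
      "\<forall>t\<in>set ts. \<exists>x\<in>S. \<exists>y\<in>orbit v x. x \<noteq> y \<and> t = Transposition.transpose x y"
      by blast
    show ?thesis
    proof (intro exI[of _ "t # ts"] conjI ballI)
      show "length (t # ts) + cycle_count S w \<le> card S" using ts(1) more by simp
      show "foldr (\<circ>) (t # ts) id = w" using ts(2) tv by simp
      fix s assume "s \<in> set (t # ts)"
      then consider "s = t" | "s \<in> set ts" by auto
      then show "\<exists>x\<in>S. \<exists>y\<in>orbit w x. x \<noteq> y \<and> s = Transposition.transpose x y"
      proof cases
        case 1
        then show ?thesis using x xS orbit.base[of w x] unfolding t_def by metis
      next
        case 2
        then show ?thesis using ts(3) orbit_sub by blast
      qed
    qed
  qed
qed

section \<open>Reflection length in the symmetric group\<close>

lemma group_prod_cox_A: "group_prod (cox_A n) ts = foldr (\<circ>) ts id"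
  by (simp add: group_prod_def sym_group_def)

lemma reflections_A_eq: "reflections_A n = reflections_on {1..n + 1}"
proof
  show "reflections_on {1..n + 1} \<subseteq> reflections_A n"
  proof
    fix t assume "t \<in> reflections_on {1..n + 1}"
    then obtain x y where xy: "t = Transposition.transpose x y"
        "x \<in> {1..n + 1}" "y \<in> {1..n + 1}" "x \<noteq> y"
      unfolding reflections_on_def by blast
    then consider "x < y" | "y < x" by linarith
    then show "t \<in> reflections_A n"
      unfolding reflections_A_def using xy by cases (auto, metis transpose_commute)
  qed
qed (fastforce simp: reflections_A_def reflections_on_def)

text \<open>The lower bound for arbitrary words and the word obtained by splitting off fixed points
  meet.\<close>

lemma word_len_reflections_A:
  assumes "w permutes {1..n + 1}"
  shows "word_len (cox_A n) (reflections_A n) w + cycle_count {1..n + 1} w = n + 1"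
proof -
  let ?S = "{1..n + 1}"
  have "word_len (cox_A n) (reflections_A n) w = n + 1 - cycle_count ?S w"
    unfolding word_len_def group_prod_cox_A reflections_A_eq
  proof (rule Least_equality)
    obtain ts where ts: "length ts + cycle_count ?S w \<le> card ?S" "foldr (\<circ>) ts id = w"
      "\<forall>t\<in>set ts. \<exists>x\<in>?S. \<exists>y\<in>orbit w x. x \<noteq> y \<and> t = Transposition.transpose x y"
      using reflection_word_in_cycles[OF _ assms] by blast
    have sub: "set ts \<subseteq> reflections_on ?S"
      using ts(3) permutes_orbit_subset[OF assms] unfolding reflections_on_def by blast
    have "n + 1 \<le> cycle_count ?S w + length ts"
      using card_le_cycle_count_add_length[OF _ sub] ts(2) by simp
    then have "length ts = n + 1 - cycle_count ?S w" using ts(1) by simp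
    then show "\<exists>ts. length ts = n + 1 - cycle_count ?S w \<and> set ts \<subseteq> reflections_on ?S \<and>
        foldr (\<circ>) ts id = w"
      using sub ts(2) by blast
  next
    fix k assume "\<exists>ts. length ts = k \<and> set ts \<subseteq> reflections_on ?S \<and> foldr (\<circ>) ts id = w"
    then show "n + 1 - cycle_count ?S w \<le> k"
      using card_le_cycle_count_add_length[of ?S] by fastforce
  qed
  moreover have "cycle_count ?S w \<le> n + 1" using cycle_count_le_card[of ?S w] by simp
  ultimately show ?thesis by simp
qed

section \<open>Descents\<close>

definition weak_descents :: "'a::linorder set \<Rightarrow> ('a \<Rightarrow> 'a) \<Rightarrow> 'a set" where
  "weak_descents S w = {i \<in> S. w i \<le> i}"

lemma Max_orbit_weak_descent:
  fixes w :: "'a::linorder \<Rightarrow> 'a"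
  assumes S: "finite S" and w: "w permutes S" and i: "i \<in> S"
  shows "Max (orbit w i) \<in> weak_descents S w" "Max (orbit w i) \<in> orbit w i"
proof -
  have sub: "orbit w i \<subseteq> S" by (rule permutes_orbit_subset[OF w i])
  then have fin: "finite (orbit w i)" using S finite_subset by blast
  show *: "Max (orbit w i) \<in> orbit w i" by (rule Max_in[OF fin orbit_nonempty])
  have "w (Max (orbit w i)) \<le> Max (orbit w i)"
    by (rule Max_ge[OF fin orbit.step[OF *]])
  then show "Max (orbit w i) \<in> weak_descents S w"
    using * sub by (auto simp: weak_descents_def)
qed

lemma inj_on_Max_orbit:
  fixes w :: "'a::linorder \<Rightarrow> 'a"
  assumes S: "finite S" and w: "w permutes S"
  shows "inj_on Max (orbit w ` S)"
proof (rule inj_onI, clarify)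
  fix i j assume ij: "i \<in> S" "j \<in> S" "Max (orbit w i) = Max (orbit w j)"
  have pw: "permutation w" using w S permutation_permutes by blast
  show "orbit w i = orbit w j"
    using Max_orbit_weak_descent(2)[OF S w] ij orbit_eq_orbit_if_mem[OF pw] by metis
qed

lemma cycle_count_le_weak_descents:
  fixes w :: "'a::linorder \<Rightarrow> 'a"
  assumes S: "finite S" and w: "w permutes S"
  shows "cycle_count S w \<le> card (weak_descents S w)"
  unfolding cycle_count_def
  by (rule card_inj_on_le[OF inj_on_Max_orbit[OF S w]])
    (use S Max_orbit_weak_descent(1)[OF S w] in \<open>auto simp: weak_descents_def\<close>)

text \<open>\<open>Max\<close> injects the cycles into the weak descents; between finite sets of
  equal size this injection is onto.\<close>

lemma weak_descents_eq_Max_orbits: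
  fixes w :: "'a::linorder \<Rightarrow> 'a"
  assumes S: "finite S" and w: "w permutes S"
    and eq: "cycle_count S w = card (weak_descents S w)"
  shows "weak_descents S w = Max ` orbit w ` S"
proof (rule card_subset_eq[symmetric])
  show "finite (weak_descents S w)" using S by (simp add: weak_descents_def)
  show "Max ` orbit w ` S \<subseteq> weak_descents S w"
    using Max_orbit_weak_descent(1)[OF S w] by auto
  show "card (Max ` orbit w ` S) = card (weak_descents S w)"
    using card_image[OF inj_on_Max_orbit[OF S w]] eq by (simp add: cycle_count_def)
qed

lemma weak_descents_le_cycle_count:
  fixes w :: "'a::linorder \<Rightarrow> 'a"
  assumes S: "finite S"
    and unique: "\<And>i j. i \<in> weak_descents S w \<Longrightarrow> j \<in> weak_descents S w \<Longrightarrow>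
      orbit w i = orbit w j \<Longrightarrow> i = j"
  shows "card (weak_descents S w) \<le> cycle_count S w"
  unfolding cycle_count_def
  by (rule card_inj_on_le[of "orbit w"])
    (use S unique in \<open>auto simp: weak_descents_def intro!: inj_onI\<close>)

section \<open>The Coxeter element and the descent criterion for \<open>NC_A\<close>\<close>

lemma coxeter_elt_permutes: "coxeter_elt n permutes {1..n + 1}"
proof (rule bij_imp_permutes)
  show "coxeter_elt n x = x" if "x \<notin> {1..n + 1}" for x
    using that by (auto simp: coxeter_elt_apply)
  have "inj_on (coxeter_elt n) {1..n + 1}"
    by (auto simp: inj_on_def coxeter_elt_apply split: if_splits)
  moreover have "coxeter_elt n ` {1..n + 1} \<subseteq> {1..n + 1}"
    by (auto simp: coxeter_elt_apply)
  ultimately show "bij_betw (coxeter_elt n) {1..n + 1} {1..n + 1}"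
    by (simp add: bij_betw_def endo_inj_surj)
qed

text \<open>The only weak descent is \<open>n + 1\<close>, which leaves room for just one
  cycle.\<close>

lemma cycle_count_coxeter_elt: "cycle_count {1..n + 1} (coxeter_elt n) = 1"
proof -
  let ?c = "coxeter_elt n" and ?S = "{1..n + 1}"
  have "weak_descents ?S ?c = {n + 1}"
    by (auto simp: weak_descents_def coxeter_elt_apply)
  then have "cycle_count ?S ?c \<le> 1"
    using cycle_count_le_weak_descents[OF _ coxeter_elt_permutes, of n] by simp
  moreover have "cycle_count ?S ?c \<noteq> 0" by (simp add: cycle_count_def)
  ultimately show ?thesis by simp
qed

text \<open>With \<open>u = w\<^sup>-\<^sup>1c\<close> one has \<open>u(i) = w\<^sup>-\<^sup>1(i+1)\<close> for \<open>i \<le> n\<close>, so \<open>i\<close> is a weak descent of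
  \<open>u\<close> exactly if \<open>w\<^sup>-\<^sup>1(i+1)\<close> is not one of \<open>w\<close>; the extra weak descent is \<open>n + 1\<close>.\<close>

lemma card_weak_descents_complement:
  assumes w: "w permutes {1..n + 1}"
  shows "card (weak_descents {1..n + 1} w) +
    card (weak_descents {1..n + 1} (inv' w \<circ> coxeter_elt n)) = n + 2"
proof -
  let ?S = "{1..n + 1}" and ?u = "inv' w \<circ> coxeter_elt n"
  have inv_in: "inv' w j \<in> ?S \<longleftrightarrow> j \<in> ?S" for j
    using permutes_in_image[OF permutes_inv[OF w]] .
  have w_in: "w j \<in> ?S \<longleftrightarrow> j \<in> ?S" for j
    using permutes_in_image[OF w] .
  have wi: "w (inv' w j) = j" "inv' w (w j) = j" for j
    using permutes_inverses[OF w] by auto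
  \<comment> \<open>These are the weak descents of \<open>?u\<close> below \<open>n + 1\<close>; at
    \<open>n + 1\<close> itself the value is \<open>inv' w 1\<close>, which is at most
    \<open>n + 1\<close>.\<close>
  define D where "D = {i \<in> {1..n}. inv' w (i + 1) \<le> i}"
  have "weak_descents ?S ?u = insert (n + 1) D"
    using inv_in[of 1] by (auto simp: weak_descents_def D_def coxeter_elt_apply le_Suc_eq)
  then have 1: "card (weak_descents ?S ?u) = Suc (card D)"
    by (simp add: D_def)
  have "bij_betw (\<lambda>i. inv' w (i + 1)) D (?S - weak_descents ?S w)"
  proof (rule bij_betw_byWitness[where f' = "\<lambda>m. w m - 1"])
    show "\<forall>i\<in>D. w (inv' w (i + 1)) - 1 = i" by (simp add: wi)
    show "\<forall>m\<in>?S - weak_descents ?S w. inv' w (w m - 1 + 1) = m"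
    proof
      fix m assume "m \<in> ?S - weak_descents ?S w"
      then have "w m - 1 + 1 = w m" by (auto simp: weak_descents_def)
      then show "inv' w (w m - 1 + 1) = m" using wi(2) by simp
    qed
    show "(\<lambda>i. inv' w (i + 1)) ` D \<subseteq> ?S - weak_descents ?S w"
    proof
      fix m assume "m \<in> (\<lambda>i. inv' w (i + 1)) ` D"
      then obtain i where i: "i \<in> {1..n}" "m \<le> i" "m = inv' w (i + 1)" by (auto simp: D_def)
      then have "m \<in> ?S" using inv_in[of "i + 1"] by simp
      moreover have "\<not> w m \<le> m" using i(2) wi(1)[of "i + 1"] unfolding i(3)[symmetric] by simp
      ultimately show "m \<in> ?S - weak_descents ?S w" by (simp add: weak_descents_def)
    qed
    show "(\<lambda>m. w m - 1) ` (?S - weak_descents ?S w) \<subseteq> D"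
    proof
      fix i assume "i \<in> (\<lambda>m. w m - 1) ` (?S - weak_descents ?S w)"
      then obtain m where m: "m \<in> ?S - weak_descents ?S w" "i = w m - 1" by (rule imageE)
      then have "m \<in> ?S" "m < w m" by (auto simp: weak_descents_def)
      then have i: "i + 1 = w m" "1 \<le> i" "i \<le> n" "m \<le> i" using w_in[of m] m(2) by auto
      then show "i \<in> D" by (simp add: D_def wi(2))
    qed
  qed
  from bij_betw_same_card[OF this]
  have "card D = card (?S - weak_descents ?S w)" .
  also have "\<dots> = card ?S - card (weak_descents ?S w)"
    by (rule card_Diff_subset) (auto simp: weak_descents_def)
  finally have "card D = n + 1 - card (weak_descents ?S w)" by simp
  moreover have "card (weak_descents ?S w) \<le> card ?S"
    by (rule card_mono) (auto simp: weak_descents_def)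
  ultimately show ?thesis using 1 by simp
qed

text \<open>By the length formula, and since the Coxeter element has one cycle,
  \<open>w \<le>\<^sub>T c\<close> says that the two cycle counts add up to \<open>n + 2\<close>.
  The weak descents have this total as well and bound the cycle counts from above, so both bounds
  must be attained.\<close>

lemma NC_A_iff:
  "w \<in> NC_A n \<longleftrightarrow> w permutes {1..n + 1} \<and>
    cycle_count {1..n + 1} w = card (weak_descents {1..n + 1} w) \<and>
    cycle_count {1..n + 1} (inv' w \<circ> coxeter_elt n) =
      card (weak_descents {1..n + 1} (inv' w \<circ> coxeter_elt n))"
proof (cases "w permutes {1..n + 1}")
  case False
  then show ?thesis by (simp add: NC_A_def sym_group_carrier)
next
  case True
  let ?S = "{1..n + 1}" and ?u = "inv' w \<circ> coxeter_elt n"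
  let ?l = "word_len (cox_A n) (reflections_A n)"
  have u: "?u permutes ?S"
    by (rule permutes_compose[OF coxeter_elt_permutes permutes_inv[OF True]])
  have id: "id permutes ?S" by (rule permutes_id)
  have one: "abs_le (cox_A n) (reflections_A n) \<one>\<^bsub>cox_A n\<^esub> w"
  proof -
    have "?l id = 0" using word_len_reflections_A[OF id] by (simp add: cycle_count_id)
    then show ?thesis
      using id by (simp add: abs_le_def sym_group_one sym_group_mult sym_group_carrier)
  qed
  have "inv\<^bsub>cox_A n\<^esub> w \<otimes>\<^bsub>cox_A n\<^esub> coxeter_elt n = ?u"
    using True by (simp add: sym_group_mult sym_group_carrier)
  then have "w \<in> NC_A n \<longleftrightarrow> ?l (coxeter_elt n) = ?l w + ?l ?u"
    using True one unfolding NC_A_def abs_le_def by (simp add: sym_group_carrier)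
  also have "\<dots> \<longleftrightarrow> cycle_count ?S w + cycle_count ?S ?u = n + 2"
    using word_len_reflections_A[OF True] word_len_reflections_A[OF u]
      word_len_reflections_A[OF coxeter_elt_permutes[of n]] cycle_count_coxeter_elt[of n] by linarith
  also have "\<dots> \<longleftrightarrow> cycle_count ?S w = card (weak_descents ?S w) \<and>
      cycle_count ?S ?u = card (weak_descents ?S ?u)"
    using card_weak_descents_complement[OF True]
      cycle_count_le_weak_descents[OF _ True] cycle_count_le_weak_descents[OF _ u] by auto
  finally show ?thesis using True by simp
qed

section \<open>The permutation of a partition\<close>

text \<open>This is the cyclic successor in increasing order; iterating it runs through a finite
  block.\<close>

definition next_in :: "'a::linorder set \<Rightarrow> 'a \<Rightarrow> 'a" where
  "next_in B i = (if {j \<in> B. i < j} = {} then Min B else Min {j \<in> B. i < j})"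

text \<open>The union names the block of \<open>i\<close> without a choice: in a partition the
  family \<open>{B \<in> P. i \<in> B}\<close> is a singleton.\<close>

definition block_perm :: "'a::linorder set set \<Rightarrow> 'a \<Rightarrow> 'a" where
  "block_perm P i = (if i \<in> \<Union>P then next_in (\<Union>{B \<in> P. i \<in> B}) i else i)"

lemma next_in_mem:
  assumes "finite B" "i \<in> B"
  shows "next_in B i \<in> B"
proof (cases "{j \<in> B. i < j} = {}")
  case True
  then show ?thesis using assms Min_in[of B] unfolding next_in_def by (metis empty_iff)
next
  case False
  then have "Min {j \<in> B. i < j} \<in> {j \<in> B. i < j}" using assms by (intro Min_in) auto
  then show ?thesis unfolding next_in_def if_not_P[OF False] by blast
qed

lemma next_in_le:
  assumes "finite B" "j \<in> B" "i < j"
  shows "next_in B i \<le> j"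
proof -
  have "j \<in> {j \<in> B. i < j}" using assms by simp
  then show ?thesis unfolding next_in_def using assms(1) by (auto intro: Min_le)
qed

lemma less_next_in:
  assumes "finite B" "j \<in> B" "i < j"
  shows "i < next_in B i"
proof -
  have ne: "{j \<in> B. i < j} \<noteq> {}" using assms by blast
  then have "Min {j \<in> B. i < j} \<in> {j \<in> B. i < j}" using assms by (intro Min_in) auto
  then show ?thesis unfolding next_in_def if_not_P[OF ne] by blast
qed

lemma next_in_Max:
  assumes "finite B"
  shows "next_in B (Max B) = Min B"
proof -
  have "{j \<in> B. Max B < j} = {}" using assms by (auto simp: not_less)
  then show ?thesis by (simp add: next_in_def)
qed

text \<open>If \<open>i\<close> were not the maximum, \<open>Max B\<close> would be a larger element
  and the successor would move up.\<close>

lemma next_in_descent: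
  assumes "finite B" "i \<in> B" "next_in B i \<le> i"
  shows "i = Max B"
  using assms less_next_in[of B "Max B" i] by (metis Max_ge Max_in empty_iff leD order_le_imp_less_or_eq)

text \<open>A common successor of \<open>i < j\<close> is at most \<open>j\<close>, so
  \<open>j\<close> is the maximum and the successor is \<open>Min B\<close>; but the successor of
  \<open>i\<close> exceeds \<open>i\<close>.\<close>

lemma inj_on_next_in:
  assumes B: "finite B"
  shows "inj_on (next_in B) B"
proof (rule linorder_inj_onI')
  fix i j assume ij: "i \<in> B" "j \<in> B" "i < j"
  show "next_in B i \<noteq> next_in B j"
  proof
    assume eq: "next_in B i = next_in B j"
    have "next_in B j \<le> j" using next_in_le[OF B ij(2,3)] eq by simp
    then have "next_in B j = Min B"
      using next_in_descent[OF B ij(2)] next_in_Max[OF B] by metis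
    moreover have "Min B \<le> i" using B ij(1) by simp
    ultimately show False using less_next_in[OF B ij(2,3)] eq by simp
  qed
qed

lemma block_perm_in_block:
  assumes P: "partition_on S P" and B: "B \<in> P" "i \<in> B"
  shows "block_perm P i = next_in B i"
proof -
  have "{B \<in> P. i \<in> B} = {B}"
    using P B unfolding partition_on_def disjoint_def by blast
  then have "\<Union>{B \<in> P. i \<in> B} = B" by simp
  then show ?thesis using B by (auto simp: block_perm_def)
qed

lemma partition_on_block_subset: "partition_on S P \<Longrightarrow> B \<in> P \<Longrightarrow> B \<subseteq> S"
  by (auto simp: partition_on_def)

lemma block_perm_permutes:
  assumes S: "finite S" and P: "partition_on S P"
  shows "block_perm P permutes S"
proof (rule bij_imp_permutes)
  have cover: "\<exists>B\<in>P. i \<in> B" if "i \<in> S" for i using P that by (auto simp: partition_on_def)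
  have fin: "finite B" if "B \<in> P" for B
    using partition_on_block_subset[OF P that] S finite_subset by blast
  show "block_perm P x = x" if "x \<notin> S" for x
    using P that by (auto simp: block_perm_def partition_on_def)
  have mem: "block_perm P i \<in> B" if "B \<in> P" "i \<in> B" for B i
    using next_in_mem[OF fin] block_perm_in_block[OF P] that by metis
  have "inj_on (block_perm P) S"
  proof (rule inj_onI)
    fix i j assume "i \<in> S" "j \<in> S" and eq: "block_perm P i = block_perm P j"
    then obtain B C where BC: "B \<in> P" "i \<in> B" "C \<in> P" "j \<in> C" using cover by meson
    then have "block_perm P i \<in> B \<inter> C" using mem eq by (metis IntI)
    then have "B = C" using P BC by (auto simp: partition_on_def disjoint_def)
    then show "i = j"
      using eq BC block_perm_in_block[OF P] inj_on_next_in[OF fin] by (metis inj_onD)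
  qed
  moreover have "block_perm P ` S \<subseteq> S"
    using cover mem partition_on_block_subset[OF P] by blast
  ultimately show "bij_betw (block_perm P) S S"
    using S by (simp add: bij_betw_def endo_inj_surj)
qed

text \<open>The maximum of the orbit is a weak descent, hence equals \<open>Max B\<close>, so
  \<open>Min B\<close> is reached next. A least missing element of \<open>B\<close> would be the
  successor of the element just before it, which is in the orbit.\<close>

lemma orbit_block_perm:
  assumes S: "finite S" and P: "partition_on S P" and B: "B \<in> P" "i \<in> B"
  shows "orbit (block_perm P) i = B"
proof
  let ?w = "block_perm P"
  let ?O = "orbit ?w i"
  have fB: "finite B" using partition_on_block_subset[OF P B(1)] S finite_subset by blast
  have w: "?w j = next_in B j" if "j \<in> B" for j using block_perm_in_block[OF P B(1) that] .
  show sub: "?O \<subseteq> B"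
    by (rule orbit_subset_if_closed) (use B w next_in_mem[OF fB] in auto)
  then have fO: "finite ?O" using fB finite_subset by blast
  have M: "Max ?O \<in> ?O" by (rule Max_in[OF fO orbit_nonempty])
  have "?w (Max ?O) \<le> Max ?O" using fO M by (simp add: orbit.step)
  then have "Max ?O = Max B" using next_in_descent[OF fB] M sub w by (metis subsetD)
  then have min: "Min B \<in> ?O"
    using next_in_Max[OF fB] w orbit.step[OF M] M sub by (metis subsetD)
  show "B \<subseteq> ?O"
  proof (rule ccontr)
    assume "\<not> B \<subseteq> ?O"
    then have ne: "B - ?O \<noteq> {}" by blast
    define y where "y = Min (B - ?O)"
    have y: "y \<in> B - ?O" unfolding y_def using ne fB by (intro Min_in) auto
    have below: "z \<in> ?O" if "z \<in> B" "z < y" for z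
      using that fB unfolding y_def by (metis Diff_iff Min_le finite_Diff leD)
    let ?L = "{z \<in> B. z < y}"
    have "Min B < y" using y min fB by (metis Diff_iff Min_le order_le_imp_less_or_eq)
    then have "?L \<noteq> {}" using min sub by blast
    then have p: "Max ?L \<in> ?L" using fB by (intro Max_in) auto
    then have "next_in B (Max ?L) \<le> y" "Max ?L < next_in B (Max ?L)" "next_in B (Max ?L) \<in> B"
      using next_in_le[OF fB] less_next_in[OF fB] next_in_mem[OF fB] y by auto
    moreover have "\<not> next_in B (Max ?L) < y"
    proof
      assume "next_in B (Max ?L) < y"
      then have "next_in B (Max ?L) \<le> Max ?L"
        using fB \<open>next_in B (Max ?L) \<in> B\<close> by (intro Max_ge) auto
      then show False using \<open>Max ?L < next_in B (Max ?L)\<close> by simp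
    qed
    ultimately have "?w (Max ?L) = y" using w p by auto
    moreover have "Max ?L \<in> ?O" using below p by blast
    ultimately show False using orbit.step[of "Max ?L" ?w i] y by auto
  qed
qed

lemma orbits_block_perm:
  assumes S: "finite S" and P: "partition_on S P"
  shows "orbit (block_perm P) ` S = P"
proof
  show "orbit (block_perm P) ` S \<subseteq> P"
    using P orbit_block_perm[OF S P] by (auto simp: partition_on_def)
  show "P \<subseteq> orbit (block_perm P) ` S"
  proof
    fix B assume B: "B \<in> P"
    with P obtain i where "i \<in> B" by (metis partition_on_def ex_in_conv)
    then show "B \<in> orbit (block_perm P) ` S"
      using orbit_block_perm[OF S P B] partition_on_block_subset[OF P B] by blast
  qed
qed

text \<open>Only the maximum of a block is a weak descent, so a weak descent is recovered from its
  cycle.\<close>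

lemma cycle_count_block_perm:
  fixes S :: "'a::linorder set"
  assumes S: "finite S" and P: "partition_on S P"
  shows "cycle_count S (block_perm P) = card (weak_descents S (block_perm P))"
proof (rule antisym)
  let ?w = "block_perm P"
  show "cycle_count S ?w \<le> card (weak_descents S ?w)"
    by (rule cycle_count_le_weak_descents[OF S block_perm_permutes[OF S P]])
  have "i = Max (orbit ?w i)" if "i \<in> weak_descents S ?w" for i
  proof -
    from that have i: "i \<in> S" "?w i \<le> i" by (auto simp: weak_descents_def)
    then obtain B where B: "B \<in> P" "i \<in> B" using P by (auto simp: partition_on_def)
    then have "finite B" using partition_on_block_subset[OF P] S finite_subset by blast
    from next_in_descent[OF this B(2)] show ?thesis
      using i(2) block_perm_in_block[OF P B] orbit_block_perm[OF S P B] by simp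
  qed
  then show "card (weak_descents S ?w) \<le> cycle_count S ?w"
    by (intro weak_descents_le_cycle_count S) metis
qed

lemma partition_on_orbits:
  assumes "finite S" "w permutes S"
  shows "partition_on S (orbit w ` S)"
proof (rule partition_onI)
  have pw: "permutation w" using assms permutation_permutes by blast
  show "\<Union> (orbit w ` S) = S"
    using permutes_orbit_subset[OF assms(2)] permutation_self_in_orbit[OF pw] by blast
  show "disjnt p q" if "p \<in> orbit w ` S" "q \<in> orbit w ` S" "p \<noteq> q" for p q
    using that orbit_eq_orbit_if_mem[OF pw] unfolding disjnt_def by blast
  show "{} \<notin> orbit w ` S" using orbit_nonempty[of w] by auto
qed

text \<open>On each cycle \<open>w\<close> dominates the successor map pointwise, and both have the same sum.\<close>

lemma block_perm_orbits:
  fixes w :: "nat \<Rightarrow> nat"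
  assumes S: "finite S" and w: "w permutes S"
    and eq: "cycle_count S w = card (weak_descents S w)"
  shows "block_perm (orbit w ` S) = w"
proof
  fix i
  have pw: "permutation w" using S w permutation_permutes by blast
  note P = partition_on_orbits[OF S w]
  show "block_perm (orbit w ` S) i = w i"
  proof (cases "i \<in> S")
    case False
    then show ?thesis
      using permutes_not_in[OF block_perm_permutes[OF S P]] permutes_not_in[OF w] by simp
  next
    case True
    let ?O = "orbit w i"
    have iO: "i \<in> ?O" by (rule permutation_self_in_orbit[OF pw])
    have sub: "?O \<subseteq> S" by (rule permutes_orbit_subset[OF w True])
    have fO: "finite ?O" using sub S finite_subset by blast
    have "sum (next_in ?O) ?O = \<Sum>?O"
    proof -
      have "next_in ?O ` ?O = ?O"
        using next_in_mem[OF fO] by (intro endo_inj_surj fO inj_on_next_in) auto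
      then show ?thesis using sum.reindex[OF inj_on_next_in[OF fO], of id] by simp
    qed
    also have "\<Sum>?O = sum w ?O"
    proof -
      have inj: "inj_on w ?O" using permutes_inj[OF w] inj_on_subset by blast
      then have "w ` ?O = ?O"
        by (intro endo_inj_surj fO) (auto intro: orbit.step)
      then show ?thesis using sum.reindex[OF inj, of id] by simp
    qed
    finally have sums: "sum (next_in ?O) ?O = sum w ?O" .
    \<comment> \<open>At the maximum the successor is the minimum; at any other \<open>y\<close> the
      value \<open>w y\<close> is a larger element of the cycle, hence at least the next
      one.\<close>
    have le: "next_in ?O y \<le> w y" if y: "y \<in> ?O" for y
    proof (cases "y = Max ?O")
      case True
      then show ?thesis using next_in_Max[OF fO] fO orbit.step[OF y] by simp
    next
      case False
      have "y \<notin> weak_descents S w"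
      proof
        assume "y \<in> weak_descents S w"
        then obtain z where z: "z \<in> S" "y = Max (orbit w z)"
          unfolding weak_descents_eq_Max_orbits[OF S w eq] by auto
        then have "y \<in> orbit w z" using Max_orbit_weak_descent(2)[OF S w] by simp
        then show False
          using False z(2) orbit_eq_orbit_if_mem[OF pw] y by metis
      qed
      then have "y < w y" using y sub by (auto simp: weak_descents_def)
      then show ?thesis using next_in_le[OF fO orbit.step[OF y]] by simp
    qed
    have "next_in ?O i = w i"
      using sum_mono_inv[OF sums le iO fO] .
    then show ?thesis using block_perm_in_block[OF P _ iO] True by simp
  qed
qed

section \<open>Noncrossing partitions\<close>

lemma noncrossing_blocks_eq:
  assumes "P \<in> noncrossing_partitions m" "B \<in> P" "C \<in> P"
    and "a \<in> B" "c \<in> B" "b \<in> C" "d \<in> C" "a < b" "b < c" "c < d"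
  shows "B = C"
proof -
  have part: "partition_on {1..m} P" using assms(1) by (simp add: noncrossing_partitions_def)
  have "1 \<le> a" "d \<le> m"
    using partition_on_block_subset[OF part] assms by fastforce+
  then show ?thesis using assms unfolding noncrossing_partitions_def by blast
qed

text \<open>A weak descent \<open>i\<close> of the complement \<open>u\<close> closes up the interval \<open>{u i..i}\<close>: the numbers
  strictly between the consecutive block elements \<open>u i\<close> and \<open>i + 1\<close> form a union of blocks.\<close>

lemma complement_orbit_subset:
  assumes P: "P \<in> noncrossing_partitions (n + 1)"
    and u: "u = inv' (block_perm P) \<circ> coxeter_elt n"
    and i: "i \<in> weak_descents {1..n + 1} u"
  shows "orbit u i \<subseteq> {u i..i}"
proof (rule orbit_subset_if_closed)
  let ?S = "{1..n + 1}" and ?w = "block_perm P"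
  from P have part: "partition_on ?S P" by (simp add: noncrossing_partitions_def)
  have w: "?w permutes ?S" by (rule block_perm_permutes[OF _ part]) simp
  have wu: "?w (u j) = coxeter_elt n j" for j
    using permutes_inverses(1)[OF w] by (simp add: u)
  have up: "u permutes ?S"
    unfolding u by (rule permutes_compose[OF coxeter_elt_permutes permutes_inv[OF w]])
  have u_in: "u j \<in> ?S" if "j \<in> ?S" for j using permutes_in_image[OF up] that by simp
  \<comment> \<open>Since \<open>?w\<close> maps \<open>u j\<close> to
    \<open>coxeter_elt n j\<close>, these two are cyclically consecutive in one block.\<close>
  have next_block: "\<exists>B\<in>P. finite B \<and> u j \<in> B \<and> coxeter_elt n j \<in> B \<and>
      coxeter_elt n j = next_in B (u j)" if j: "j \<in> ?S" for j
  proof -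
    obtain B where B: "B \<in> P" "u j \<in> B"
using part u_in[OF j] unfolding partition_on_def by blast
    have "finite B" using partition_on_block_subset[OF part B(1)] finite_subset by blast
    then show ?thesis
      using B next_in_mem block_perm_in_block[OF part B] wu[of j] by metis
  qed
  from i have iS: "i \<in> ?S" and ui: "u i \<le> i" by (auto simp: weak_descents_def)
  from ui show "i \<in> {u i..i}" by simp
  fix j assume j: "j \<in> {u i..i}"
  show "u j \<in> {u i..i}"
  proof (cases "j = i")
    case False
    with j iS u_in[OF iS] have jn: "j \<in> ?S" "j \<le> n" "j < i" "u i \<le> j" by auto
    obtain B where B: "B \<in> P" "finite B" "u i \<in> B" "coxeter_elt n i \<in> B"
      "coxeter_elt n i = next_in B (u i)" using next_block[OF iS] by blast
    obtain C where C: "C \<in> P" "u j \<in> C" "coxeter_elt n j \<in> C"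
      using next_block[OF jn(1)] by blast
    have cj: "coxeter_elt n j = j + 1" using jn by (simp add: coxeter_elt_apply)
    \<comment> \<open>As \<open>u i < j + 1 \<le> i\<close>, membership would put the successor of
      \<open>u i\<close> above \<open>u i\<close> and at most at \<open>i\<close>; but it is
      \<open>i + 1\<close>, or 1 if \<open>i = n + 1\<close>.\<close>
    have jB: "j + 1 \<notin> B"
    proof
      assume "j + 1 \<in> B"
      then have "next_in B (u i) \<le> j + 1" "u i < next_in B (u i)"
        using next_in_le[OF B(2)] less_next_in[OF B(2)] jn by auto
      then show False using B(5) jn iS u_in[OF iS] by (auto simp: coxeter_elt_apply split: if_splits)
    qed
    then have BC: "B \<noteq> C" using C cj by auto
    then have disj: "B \<inter> C = {}" using part B C by (auto simp: partition_on_def disjoint_def)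
    have ne: "u j \<noteq> u i" "u j \<noteq> coxeter_elt n i" using disj B C by auto
    have "\<not> u j < u i"
    proof
      assume lt: "u j < u i"
      \<comment> \<open>If \<open>i = n + 1\<close>, the successor wraps around to 1 and the
        crossing is \<open>1 < u j < u i < j + 1\<close>; otherwise it is
        \<open>u j < u i < j + 1 < i + 1\<close>.\<close>
      show False
      proof (cases "i = n + 1")
        case True
        then have "1 \<in> B" using B(4) by (simp add: coxeter_elt_apply)
        moreover have "1 < u j" using u_in[OF jn(1)] ne(2) True by (auto simp: coxeter_elt_apply)
        ultimately show False
          using noncrossing_blocks_eq[OF P B(1) C(1), of 1 "u i" "u j" "j + 1"] B C cj lt jn BC
          by auto
      next
        case False
        then have "i + 1 \<in> B" using B(4) iS by (simp add: coxeter_elt_apply)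
        then show False
          using noncrossing_blocks_eq[OF P C(1) B(1), of "u j" "j + 1" "u i" "i + 1"]
            B C cj lt jn BC by auto
      qed
    qed
    \<comment> \<open>Here the crossing is \<open>u i < j + 1 < i + 1 < u j\<close>.\<close>
    moreover have "\<not> i < u j"
    proof
      assume lt: "i < u j"
      then have "i \<noteq> n + 1" using u_in[OF jn(1)] by auto
      then have ci: "coxeter_elt n i = i + 1" using iS by (simp add: coxeter_elt_apply)
      then have "i + 1 < u j" using lt ne by auto
      then show False
        using noncrossing_blocks_eq[OF P B(1) C(1), of "u i" "i + 1" "j + 1" "u j"]
          B C cj ci jn BC by auto
    qed
    ultimately show ?thesis by simp
  qed (use ui in simp)
qed

text \<open>For the complement, two weak descents in one cycle lie in each other's closed-up
  interval, so each is at most the other.\<close>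

lemma block_perm_in_NC_A:
  assumes P: "P \<in> noncrossing_partitions (n + 1)"
  shows "block_perm P \<in> NC_A n"
proof -
  let ?S = "{1..n + 1}" and ?w = "block_perm P"
  define u where "u = inv' ?w \<circ> coxeter_elt n"
  from P have part: "partition_on ?S P" by (simp add: noncrossing_partitions_def)
  have w: "?w permutes ?S" by (rule block_perm_permutes[OF _ part]) simp
  have up: "u permutes ?S"
    unfolding u_def by (rule permutes_compose[OF coxeter_elt_permutes permutes_inv[OF w]])
  then have "permutation u" using permutation_permutes by blast
  then have self: "j \<in> orbit u j" for j by (rule permutation_self_in_orbit)
  have "card (weak_descents ?S u) \<le> cycle_count ?S u"
  proof (rule weak_descents_le_cycle_count)
    fix i j assume ij: "i \<in> weak_descents ?S u" "j \<in> weak_descents ?S u" "orbit u i = orbit u j"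
    then have "j \<in> {u i..i}" "i \<in> {u j..j}"
      using complement_orbit_subset[OF P u_def] self by blast+
    then show "i = j" by simp
  qed simp
  moreover have "cycle_count ?S u \<le> card (weak_descents ?S u)"
    by (rule cycle_count_le_weak_descents[OF _ up]) simp
  ultimately show ?thesis
    using w cycle_count_block_perm[OF _ part] by (simp add: NC_A_iff flip: u_def)
qed

text \<open>This is the part of Biane's bijection that makes \<open>positive_partition\<close>
  computable: \<open>block_perm\<close> is a left inverse of \<open>cycle_partition n\<close> on
  \<open>NC_A n\<close>, and \<open>P\<close> is the image of \<open>block_perm P\<close>.\<close>

lemma the_inv_into_cycle_partition:
  assumes P: "P \<in> noncrossing_partitions (n + 1)"
  shows "the_inv_into (NC_A n) (cycle_partition n) P = block_perm P"
proof (rule the_inv_into_f_eq)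
  show "inj_on (cycle_partition n) (NC_A n)"
  proof (rule inj_on_inverseI)
    show "block_perm (cycle_partition n w) = w" if "w \<in> NC_A n" for w
      using that block_perm_orbits[of "{1..n + 1}" w] unfolding NC_A_iff cycle_partition_def by simp
  qed
  show "cycle_partition n (block_perm P) = P"
    using P orbits_block_perm[of "{1..n + 1}" P]
    by (simp add: cycle_partition_def noncrossing_partitions_def)
  show "block_perm P \<in> NC_A n" by (rule block_perm_in_NC_A[OF P])
qed

section \<open>Parabolic subgroups\<close>

lemma simple_gen_eq_iff: "simple_gen i = simple_gen j \<longleftrightarrow> i = j"
proof
  assume "simple_gen i = simple_gen j"
  then have "simple_gen i i = simple_gen j i" "simple_gen i j = simple_gen j j" by simp_all
  then show "i = j"
    by (auto simp: simple_gen_def Transposition.transpose_def split: if_splits)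
qed simp

lemma simple_gen_in_carrier: "i \<in> {1..n} \<Longrightarrow> simple_gen i \<in> carrier (cox_A n)"
  unfolding simple_gen_def sym_group_carrier by (intro permutes_swap_id) auto

text \<open>A proper subset of the generators misses some \<open>simple_gen k\<close>; every other
  one preserves \<open>{..k}\<close>, and so do products.\<close>

lemma parabolic_preserves_interval:
  assumes J: "J \<subset> simple_gens n" and w: "w \<in> generate (cox_A n) J"
  obtains k where "k \<in> {1..n}" "\<And>x. w x \<le> k \<longleftrightarrow> x \<le> k"
proof -
  from J obtain k where k: "k \<in> {1..n}" "simple_gen k \<notin> J"
    unfolding simple_gens_def by blast
  \<comment> \<open>Generators are involutions, which settles the inverses; membership in the
    carrier identifies the group inverse with \<open>inv'\<close>.\<close>
  have gen: "h \<in> carrier (cox_A n) \<and> inv' h = h \<and> (\<forall>x. h x \<le> k \<longleftrightarrow> x \<le> k)" if "h \<in> J" for h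
  proof -
    from that J obtain j where j: "h = simple_gen j" "j \<in> {1..n}"
      unfolding simple_gens_def by blast
    with k that have "j \<noteq> k" by auto
    then have "\<forall>x. h x \<le> k \<longleftrightarrow> x \<le> k"
      by (auto simp: j(1) simple_gen_def Transposition.transpose_def)
    moreover have "inv' h = h" by (simp add: j(1) simple_gen_def)
    ultimately show ?thesis using simple_gen_in_carrier[OF j(2)] j(1) by simp
  qed
  have "w x \<le> k \<longleftrightarrow> x \<le> k" for x
    using w
  proof (induction arbitrary: x)
    case one
    show ?case by (simp add: sym_group_one)
  next
    case (incl h)
    then show ?case using gen by blast
  next
    case (inv h)
    then show ?case using gen[OF inv] by simp
  next
    case (eng h1 h2)
    then show ?case by (simp add: sym_group_mult)
  qed
  with k(1) show thesis by (rule that)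
qed

text \<open>Conjugating \<open>(a b)\<close> by \<open>simple_gen b\<close> gives
  \<open>(a b+1)\<close>. Building up from \<open>simple_gen a\<close> thus uses only generators
  with index from \<open>a\<close> to \<open>b - 1\<close>, which do not include
  \<open>k\<close>.\<close>

lemma transpose_in_parabolic:
  assumes "1 \<le> a" "a < b" "b \<le> n + 1" "\<not> (a \<le> k \<and> k < b)"
  shows "Transposition.transpose a b \<in> generate (cox_A n) (simple_gens n - {simple_gen k})"
  using assms(2,3,4)
proof (induction b)
  case (Suc b)
  let ?G = "generate (cox_A n) (simple_gens n - {simple_gen k})"
  have "b \<noteq> k" "b \<in> {1..n}" using Suc.prems assms(1) by auto
  then have s: "simple_gen b \<in> ?G"
    by (intro generate.incl) (auto simp: simple_gens_def simple_gen_eq_iff)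
  show ?case
  proof (cases "a = b")
    case True
    then show ?thesis using s by (simp add: simple_gen_def)
  next
    case False
    then have "Transposition.transpose a b \<in> ?G" using Suc by auto
    then have "simple_gen b \<otimes>\<^bsub>cox_A n\<^esub> (Transposition.transpose a b \<otimes>\<^bsub>cox_A n\<^esub> simple_gen b) \<in> ?G"
      by (intro generate.eng s)
    moreover have "simple_gen b \<circ> (Transposition.transpose a b \<circ> simple_gen b) =
        Transposition.transpose a (Suc b)"
      using False Suc.prems
      by (auto simp: fun_eq_iff simple_gen_def Transposition.transpose_def)
    ultimately show ?thesis by (simp add: sym_group_mult)
  qed
qed simp

text \<open>Write \<open>w\<close> as a product of transpositions inside its cycles; both letters of
  each then lie on the same side of the gap after \<open>k\<close>.\<close>

lemma in_parabolic_if_orbits_split: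
  assumes w: "w permutes {1..n + 1}"
    and split: "\<And>i j. i \<in> {1..n + 1} \<Longrightarrow> j \<in> orbit w i \<Longrightarrow> i \<le> k \<longleftrightarrow> j \<le> k"
  shows "w \<in> generate (cox_A n) (simple_gens n - {simple_gen k})"
proof -
  let ?S = "{1..n + 1}" and ?G = "generate (cox_A n) (simple_gens n - {simple_gen k})"
  obtain ts where ts: "foldr (\<circ>) ts id = w"
    "\<forall>t\<in>set ts. \<exists>x\<in>?S. \<exists>y\<in>orbit w x. x \<noteq> y \<and> t = Transposition.transpose x y"
    using reflection_word_in_cycles[OF _ w] by blast
  have "t \<in> ?G" if "t \<in> set ts" for t
  proof -
    from ts(2) that obtain x y where xy: "x \<in> ?S" "y \<in> orbit w x" "x \<noteq> y"
      "t = Transposition.transpose x y" by blast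
    have y: "y \<in> ?S" using permutes_orbit_subset[OF w xy(1)] xy(2) by blast
    have iff: "x \<le> k \<longleftrightarrow> y \<le> k" by (rule split[OF xy(1,2)])
    show ?thesis
    proof (cases "x < y")
      case True
      then show ?thesis using xy y iff transpose_in_parabolic[of x y n k] by auto
    next
      case False
      then show ?thesis
        using xy y iff transpose_in_parabolic[of y x n k] by (auto simp: transpose_commute[of x y])
    qed
  qed
  then have "foldr (\<circ>) ts id \<in> ?G"
  proof (induction ts)
    case Nil
    then show ?case using generate.one[of "cox_A n"] by (simp add: sym_group_one id_def)
  next
    case (Cons t ts)
    have "t \<in> ?G" by (rule Cons.prems) simp
    moreover have "foldr (\<circ>) ts id \<in> ?G" by (rule Cons.IH) (rule Cons.prems, simp)
    ultimately have "t \<otimes>\<^bsub>cox_A n\<^esub> foldr (\<circ>) ts id \<in> ?G" by (rule generate.eng)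
    then show ?case unfolding sym_group_mult foldr_Cons comp_apply[of "(\<circ>) t"] .
  qed
  with ts(1) show ?thesis by simp
qed

theorem proposition7p5:
  fixes n :: nat and P :: "nat set set"
  assumes "P \<in> noncrossing_partitions (n + 1)"
  shows "positive_partition n P \<longleftrightarrow> (\<exists>B\<in>P. 1 \<in> B \<and> n + 1 \<in> B)"
proof -
  let ?S = "{1..n + 1}"
  define w where "w = block_perm P"
  from assms have part: "partition_on ?S P" by (simp add: noncrossing_partitions_def)
  have w: "w permutes ?S" unfolding w_def by (rule block_perm_permutes[OF _ part]) simp
  have orb: "orbit w i = B" if "B \<in> P" "i \<in> B" for B i
    unfolding w_def using orbit_block_perm[OF _ part that] by simp
  have "positive_partition n P \<longleftrightarrow>
      \<not> (\<exists>J. J \<subset> simple_gens n \<and> w \<in> generate (cox_A n) J)"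
    using assms block_perm_in_NC_A[OF assms]
    by (simp add: positive_partition_def positive_elt_def the_inv_into_cycle_partition w_def)
  also have "\<dots> \<longleftrightarrow> (\<exists>B\<in>P. 1 \<in> B \<and> n + 1 \<in> B)"
  proof
    assume "\<exists>B\<in>P. 1 \<in> B \<and> n + 1 \<in> B"
    then have far: "n + 1 \<in> orbit w 1" using orb by blast
    show "\<not> (\<exists>J. J \<subset> simple_gens n \<and> w \<in> generate (cox_A n) J)"
    proof
      assume "\<exists>J. J \<subset> simple_gens n \<and> w \<in> generate (cox_A n) J"
      then obtain k where k: "k \<in> {1..n}" "\<And>x. w x \<le> k \<longleftrightarrow> x \<le> k"
        using parabolic_preserves_interval by metis
      \<comment> \<open>The invariant set \<open>{..k}\<close> contains 1 but not
        \<open>n + 1\<close>.\<close>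
      have "orbit w 1 \<subseteq> {..k}" by (rule orbit_subset_if_closed) (use k in auto)
      then show False using far k(1) by auto
    qed
  next
    assume not_parabolic: "\<not> (\<exists>J. J \<subset> simple_gens n \<and> w \<in> generate (cox_A n) J)"
    have "1 \<in> ?S" by simp
    then obtain B where B: "B \<in> P" "1 \<in> B"
      using part unfolding partition_on_def by blast
    have sub: "B \<subseteq> ?S" by (rule partition_on_block_subset[OF part B(1)])
    then have fB: "finite B" using finite_subset by blast
    define k where "k = Max B"
    have k: "k \<in> B" unfolding k_def using fB B(2) by (intro Max_in) auto
    have "n + 1 \<in> B"
    proof (rule ccontr)
      assume "n + 1 \<notin> B"
      with k have "k \<noteq> n + 1" by metis
      moreover have "k \<in> ?S" using k sub by (rule set_rev_mp)
      ultimately have kn: "k \<in> {1..n}" by simp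
      \<comment> \<open>A block with \<open>i \<le> k < j\<close> would be different from
        \<open>B\<close>, and \<open>1 < i < k < j\<close> would cross \<open>B\<close> at 1 and
        \<open>k\<close>.\<close>
      have no_cross: "j \<le> k" if C: "C \<in> P" "i \<in> C" "j \<in> C" "i \<le> k" for C i j
      proof (rule ccontr)
        assume j: "\<not> j \<le> k"
        then have "j \<notin> B" using fB by (auto simp: k_def)
        then have "C \<noteq> B" using C by auto
        then have "C \<inter> B = {}" using part B C by (auto simp: partition_on_def disjoint_def)
        then have "i \<noteq> 1" "i \<noteq> k" using B k C by auto
        moreover have "1 \<le> i" using partition_on_block_subset[OF part C(1)] C(2) by auto
        ultimately have "B = C"
          using noncrossing_blocks_eq[OF assms B(1) C(1), of 1 k i j] B k C j by auto
        then show False using \<open>C \<noteq> B\<close> by simp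
      qed
      have "i \<le> k \<longleftrightarrow> j \<le> k" if "i \<in> ?S" "j \<in> orbit w i" for i j
      proof -
        have "i \<in> \<Union>P" using that(1) unfolding partition_onD1[OF part] .
        then obtain C where C: "C \<in> P" "i \<in> C" by (rule UnionE)
        have "j \<in> C" using that(2) unfolding orb[OF C] .
        then show ?thesis using no_cross[OF C(1)] C(2) by metis
      qed
      with w have "w \<in> generate (cox_A n) (simple_gens n - {simple_gen k})"
        by (rule in_parabolic_if_orbits_split)
      \<comment> \<open>The inclusion is proper because \<open>k \<le> n\<close> makes
        \<open>simple_gen k\<close> one of the generators.\<close>
      moreover have "simple_gens n - {simple_gen k} \<subset> simple_gens n"
        using kn by (auto simp: simple_gens_def)
      ultimately show False using not_parabolic by metis
    qed
    with B show "\<exists>B\<in>P. 1 \<in> B \<and> n + 1 \<in> B" by blast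
  qed
  finally show ?thesis .
qed

end
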